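(* Let $n$ be a power of $2$, and let $f$ and $g$ be two polynomials of degree $n-1$ in the same indeterminate $x$ with coefficients in a commutative ring $R$. Then $$f\times g=\sum_{k=0}^{n-1}\sigma_k\,S_{n-1-k}\cdot\Big(\big(S_{n-1-k}\,x^k\big)\odot\big(\bar S_k\, f\big)\odot\big(\bar S_k\, g\big)\Big)=\sum_{k=0}^{n-1}\sigma_k\,S_{n-1-k}\cdot\Big(\big(S_{n-1-k}\,x^k\big)\odot\big(S_k\,\bar f\big)\odot\big(S_k\,\bar g\big)\Big),$$ where $f\times g$ and juxtaposition denote the ordinary product of polynomials.
   Context: Notation. For polynomials $u=\sum_j u_jx^j$ and $v=\sum_j v_jx^j$, the termwise product is $u\odot v=\sum_j u_jv_jx^j$; in an expression mixing juxtaposition and $\odot$, the ordinary products (juxtaposition) are computed first. Sierpiński's polynomials: for $m\ge 0$, $S_m=\sum_{j=0}^m T_{m,j}x^j$, where $T_{m,j}\in\{0,1\}$ is the residue of $\binom{m}{j}$ modulo $2$ (read as an integer). Thus $S_0=1$, $S_1=1+x$, $S_2=1+x^2$, $S_3=1+x+x^2+x^3$, etc. Signed Thue–Morse sequence: $\sigma_j=(-1)^{h(j)}$, where $h(j)$ is the number of digits $1$ in the binary expansion of $j\ge0$. For a polynomial $f=\sum_j a_jx^j$, $\bar f=\sum_j \sigma_ja_jx^j$. For $m=\sum_i d_i2^i$ with binary digits $d_i\in\{0,1\}$, $\bar S_m=\prod_i(1-x^{2^i})^{d_i}$. Integer-coefficient polynomials are regarded as having coefficients in $R$ via the canonical map $\mathbb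 Z\to R$. *)

theory Defs
  imports "HOL-Computational_Algebra.Polynomial"
begin

text \<open>Matching the usual convention for mixed expressions, ordinary products (priority 70)
  bind more tightly than termwise products.\<close>

lift_definition termwise_mult :: "'a::mult_zero poly \<Rightarrow> 'a poly \<Rightarrow> 'a poly" (infixl "\<odot>" 67)
  is "\<lambda>u v j. u j * v j"
  by (auto elim: MOST_rev_mp)

definition sierpinski :: "nat \<Rightarrow> int poly" where
  "sierpinski m = (\<Sum>j\<le>m. monom (int ((m choose j) mod 2)) j)"

definition thue_morse :: "nat \<Rightarrow> int" where
  "thue_morse j = (- 1) ^ card {i. bit j i}"

lift_definition signed_poly :: "'a::ring_1 poly \<Rightarrow> 'a poly"
  is "\<lambda>a j. of_int (thue_morse j) * a j"
  by (auto elim: MOST_rev_mp)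

text \<open>The set of positions of the digits 1 of a natural number is finite, so this is the full
  product over the binary digits.\<close>

definition signed_sierpinski :: "nat \<Rightarrow> int poly" where
  "signed_sierpinski m = (\<Prod>i\<in>{i. bit m i}. 1 - monom 1 (2 ^ i))"

abbreviation int_poly_to :: "int poly \<Rightarrow> 'a::comm_ring_1 poly" where
  "int_poly_to \<equiv> map_poly of_int"

abbreviation S :: "nat \<Rightarrow> 'a::comm_ring_1 poly" where
  "S m \<equiv> int_poly_to (sierpinski m)"

abbreviation S_bar :: "nat \<Rightarrow> 'a::comm_ring_1 poly" where
  "S_bar m \<equiv> int_poly_to (signed_sierpinski m)"

end

theory Submission
  imports Defs
begin

text \<open>
  Both sums are Karatsuba's multiplication scheme with its recursion unrolled.  Split polynomials
  by the parity of the exponents, $f = p(x^2) + x\,q(x^2)$ and $g = p'(x^2) + x\,q'(x^2)$;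
  below, $p(x^2) + x\,q(x^2)$ is \<open>interleave p q\<close>.  Karatsuba's identity
  \[ f g = (1 + x)\,\bigl((p p')(x^2) + x\,(q q')(x^2)\bigr)
        - x\,\bigl((q - p)(q' - p')\bigr)(x^2) \]
  computes $fg$ from three products of half the length.

  In the sum for $2n$ instead of $n$, the index $k$ is split by its lowest binary digit.  All
  ingredients are compatible with this splitting: $S_{2k}$ and $S_{2k+1}$ are $S_k(x^2)$ and
  $(1+x)\,S_k(x^2)$, likewise for $\bar S$ with $1-x$, and $\sigma_{2k+1} = -\sigma_{2k} =
  -\sigma_k$.  Since $2n-1-2k = 2(n-1-k)+1$ is odd, the mask $S_{2n-1-2k}\,x^{2k}$ keeps both
  halves of its argument, and the term $2k$ is $1 + x$ times the interleaving of the $k$-th terms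
  for $(p,p')$ and for $(q,q')$ (\<open>sierpinski_term_double\<close>).  For the index $2k+1$ the
  mask has odd exponents only.  It keeps from $(1-x)\,f$ just the odd half $q - p$ and discards the
  even half, which contains the unwanted carry $p - x q$; so the term is $-x$ times the
  $k$-th term for $(q-p,\,q'-p')$ at $x^2$ (\<open>sierpinski_term_double_plus_1\<close>).
  Summing over $k$ and using induction on $\log_2 n$ gives exactly Karatsuba's identity.

  The argument uses only how $\bar S_k f$ behaves under interleaving.  The polynomials
  $S_k \bar f$ obey the same rules up to a sign $-1$ on the odd half, which cancels because two
  such factors are multiplied termwise.  The locale \<open>karatsuba_family\<close> captures both
  cases, so that each of the two sums is shown to equal $f g$.
\<close>

section \<open>Splitting polynomials by the parity of exponents\<close>

definition interleave :: "'a::comm_ring_1 poly \<Rightarrow> 'a poly \<Rightarrow> 'a poly" where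
  "interleave p q = pcompose p (monom 1 2) + monom 1 1 * pcompose q (monom 1 2)"

lemma coeff_pcompose_square:
  "coeff (pcompose p (monom (1::'a::comm_ring_1) 2)) j = (if even j then coeff p (j div 2) else 0)"
proof (induction p arbitrary: j)
  case 0
  then show ?case by simp
next
  case (pCons a p)
  consider "j = 0" | "j = 1" | i where "j = i + 2"
    by (metis One_nat_def add_2_eq_Suc' not0_implies_Suc)
  then show ?case
    by cases (simp_all add: pcompose_pCons coeff_monom_mult coeff_pCons pCons.IH)
qed

lemma coeff_interleave:
  "coeff (interleave p q) j = (if even j then coeff p (j div 2) else coeff q (j div 2))"
proof (cases j)
  case 0
  then show ?thesis
    by (simp only: interleave_def coeff_add coeff_pcompose_square coeff_monom_mult) simp
next
  case (Suc i)
  then show ?thesis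
    by (auto simp: interleave_def coeff_pcompose_square coeff_monom_mult elim!: oddE)
qed

text \<open>Identities of the form \<open>f = interleave p q\<close> are reduced by this rule to
  statements about the coefficients at \<open>2 * j\<close> and at \<open>2 * j + 1\<close>, which is how
  the recursions below are obtained.\<close>

lemma poly_eq_interleaveI:
  assumes "\<And>j. coeff f (2 * j) = coeff p j" "\<And>j. coeff f (2 * j + 1) = coeff q j"
  shows "f = interleave p q"
proof (rule poly_eqI)
  fix j
  show "coeff f j = coeff (interleave p q) j"
    using assms by (cases "even j") (auto simp: coeff_interleave elim!: evenE oddE)
qed

text \<open>The extra factor $x$ on \<open>b * d\<close> is the carry $x \cdot x = x^2$ from the odd
  halves into the even half.\<close>

lemma interleave_mult:
  "interleave a b * interleave c d = interleave (a * c + monom 1 1 * (b * d)) (a * d + b * c)"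
proof -
  have "pcompose (monom 1 1) (monom (1::'a) 2) = monom 1 1 * monom 1 1"
    by (simp add: monom_altdef pcompose_pCons power2_eq_square)
  then show ?thesis
    by (simp add: interleave_def pcompose_add pcompose_mult algebra_simps)
qed

lemma interleave_add: "interleave a b + interleave c d = interleave (a + c) (b + d)"
  by (rule poly_eqI) (simp add: coeff_interleave)

lemma interleave_sum:
  "(\<Sum>i\<in>I. interleave (p i) (q i)) = interleave (\<Sum>i\<in>I. p i) (\<Sum>i\<in>I. q i)"
  by (rule poly_eqI) (simp add: coeff_interleave coeff_sum)

lemma smult_interleave: "smult c (interleave p q) = interleave (smult c p) (smult c q)"
  by (rule poly_eqI) (simp add: coeff_interleave)

lemma coeff_termwise_mult: "coeff (p \<odot> q) j = coeff p j * coeff q j"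
  by transfer simp

text \<open>In contrast to the ordinary product, the termwise product has no carry: it acts on the two
  halves separately, so a mask that vanishes on one half deletes that half altogether.\<close>

lemma interleave_termwise_mult: "interleave a b \<odot> interleave c d = interleave (a \<odot> c) (b \<odot> d)"
  by (rule poly_eqI) (simp add: coeff_interleave coeff_termwise_mult)

lemma monom_double: "monom 1 (2 * k) = interleave (monom 1 k) 0"
  by (rule poly_eq_interleaveI) (auto, presburger)

lemma monom_double_plus_1: "monom 1 (2 * k + 1) = interleave 0 (monom 1 k)"
  by (rule poly_eq_interleaveI) (auto, presburger)

lemma map_poly_of_int_interleave:
  "map_poly of_int (interleave p q) = interleave (map_poly of_int p) (map_poly of_int q)"
  by (rule poly_eqI) (simp add: coeff_interleave coeff_map_poly)

lemma ex_interleave: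
  fixes f :: "'a::comm_ring_1 poly"
  assumes "degree f \<le> 2 * n - 1" "0 < n"
  obtains p q where "f = interleave p q" "degree p \<le> n - 1" "degree q \<le> n - 1"
proof -
  have "\<exists>p q. f = interleave p q" for f :: "'a poly"
  proof (induction f)
    case 0
    have "0 = interleave 0 (0::'a poly)" by (simp add: interleave_def)
    then show ?case by blast
  next
    case (pCons a f)
    then obtain p q where "f = interleave p q" by blast
    (* Multiplying by x exchanges the two parities. *)
    then have "pCons a f = interleave (pCons a q) p"
      by (auto intro!: poly_eq_interleaveI simp: coeff_pCons coeff_interleave split: nat.split)
    then show ?case by blast
  qed
  then obtain p q where pq: "f = interleave p q" by blast
  have "coeff p j = coeff f (2 * j)" "coeff q j = coeff f (2 * j + 1)" for j
    by (simp_all add: pq coeff_interleave)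
  moreover have "coeff f i = 0" if "i \<ge> 2 * n" for i
    using assms that by (intro coeff_eq_0) simp
  ultimately have "degree p \<le> n - 1" "degree q \<le> n - 1"
    using assms(2) by (auto intro!: degree_le)
  with pq that show thesis by blast
qed

section \<open>Recursion on the lowest binary digit of the index\<close>

lemma bits_double: "{i. bit (2 * k) i} = Suc ` {i. bit (k::nat) i}"
proof -
  have "bit (2 * k) i \<longleftrightarrow> i \<in> Suc ` {i. bit k i}" for i
    by (cases i) (auto simp: bit_0 bit_Suc)
  then show ?thesis by blast
qed

lemma bits_double_plus_1: "{i. bit (2 * k + 1) i} = insert 0 (Suc ` {i. bit (k::nat) i})"
proof -
  have "bit (2 * k + 1) i \<longleftrightarrow> i \<in> insert 0 (Suc ` {i. bit k i})" for i
    by (cases i) (auto simp: bit_0 bit_Suc)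
  then show ?thesis by blast
qed

lemma finite_bits: "finite {i. bit (k::nat) i}"
proof -
  have "i < k" if "bit k i" for i
  proof (rule ccontr)
    assume "\<not> i < k"
    then have "k < 2 ^ i" using less_exp[of i] by linarith
    with that show False by (simp add: bit_iff_odd)
  qed
  then show ?thesis by (auto intro: finite_subset[of _ "{..<k}"])
qed

lemma thue_morse_double: "thue_morse (2 * k) = thue_morse k"
  by (simp only: thue_morse_def bits_double) (simp add: card_image)

lemma thue_morse_double_plus_1: "thue_morse (2 * k + 1) = - thue_morse k"
  by (simp only: thue_morse_def bits_double_plus_1) (simp add: card_image finite_bits)

lemma coeff_signed_poly: "coeff (signed_poly f) j = of_int (thue_morse j) * coeff f j"
  by transfer simp

lemma signed_poly_interleave:
  "signed_poly (interleave p q) = interleave (signed_poly p) (- signed_poly q)"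
  using thue_morse_double_plus_1
  by (intro poly_eq_interleaveI)
    (simp_all add: coeff_interleave coeff_signed_poly thue_morse_double)

lemma prod_interleave_squares:
  assumes "finite I"
  shows "(\<Prod>i\<in>Suc ` I. 1 - monom (1::int) (2 ^ i)) = interleave (\<Prod>i\<in>I. 1 - monom 1 (2 ^ i)) 0"
  using assms
proof induction
  case empty
  show ?case using monom_double[of 0] by (simp add: monom_0 flip: one_pCons)
next
  case (insert i I)
  have "1 - monom (1::int) (2 * 2 ^ i) = interleave (1 - monom 1 (2 ^ i)) 0"
    by (rule poly_eq_interleaveI) (auto, presburger+)
  moreover have "Suc i \<notin> Suc ` I" using insert.hyps by blast
  ultimately show ?case using insert by (simp add: interleave_mult)
qed

lemma signed_sierpinski_double:
  "signed_sierpinski (2 * k) = interleave (signed_sierpinski k) 0"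
  by (simp add: signed_sierpinski_def bits_double prod_interleave_squares finite_bits)

lemma signed_sierpinski_double_plus_1:
  "signed_sierpinski (2 * k + 1) = interleave (signed_sierpinski k) (- signed_sierpinski k)"
proof -
  have "signed_sierpinski (2 * k + 1) = (1 - monom 1 1) * interleave (signed_sierpinski k) 0"
    unfolding signed_sierpinski_def bits_double_plus_1
    by (simp add: prod_interleave_squares finite_bits)
  also have "1 - monom 1 1 = interleave 1 (- 1 :: int poly)"
    by (rule poly_eq_interleaveI) auto
  finally show ?thesis by (simp add: interleave_mult)
qed

text \<open>The case of Lucas' theorem modulo 2 in which the upper index is even.  Applying Pascal's
  rule twice gives $\binom{2k+2}{j+2} \equiv \binom{2k}{j} + \binom{2k}{j+2}$ modulo 2, which
  is Pascal's rule for $k$ when $j$ is even.\<close>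

lemma binomial_parity:
  "odd (2 * k choose (2 * j)) = odd (k choose j)" "even (2 * k choose (2 * j + 1))"
proof (induction k arbitrary: j)
  case 0
  { case 1 show ?case by (cases j) auto }
  { case 2 show ?case by simp }
next
  case (Suc k)
  note IH = Suc.IH
  { case 1
    show ?case
    proof (cases j)
      case 0
      then show ?thesis by simp
    next
      case (Suc i)
      with IH(1)[of i] IH(1)[of j] IH(2)[of i] show ?thesis by auto
    qed }
  { case 2
    show ?case
    proof (cases j)
      case 0
      then show ?thesis using IH(2)[of 0] by simp
    next
      case (Suc i)
      with IH(2)[of i] IH(2)[of j] show ?thesis by auto
    qed }
qed

lemma coeff_sierpinski: "coeff (sierpinski m) j = int ((m choose j) mod 2)"
  by (simp add: sierpinski_def coeff_sum binomial_eq_0)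

lemma sierpinski_0: "sierpinski 0 = 1"
  by (simp add: sierpinski_def monom_0 one_pCons)

lemma sierpinski_double: "sierpinski (2 * k) = interleave (sierpinski k) 0"
  using binomial_parity by (intro poly_eq_interleaveI) (auto simp: coeff_sierpinski mod2_eq_if)

lemma sierpinski_double_plus_1: "sierpinski (2 * k + 1) = interleave (sierpinski k) (sierpinski k)"
proof (rule poly_eq_interleaveI)
  fix j
  show "coeff (sierpinski (2 * k + 1)) (2 * j) = coeff (sierpinski k) j"
    using binomial_parity(1)[of k j] binomial_parity(2)[of k "j - 1"]
    by (cases j) (auto simp: coeff_sierpinski mod2_eq_if)
  show "coeff (sierpinski (2 * k + 1)) (2 * j + 1) = coeff (sierpinski k) j"
    using binomial_parity[of k j] by (auto simp: coeff_sierpinski mod2_eq_if)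
qed

section \<open>The Karatsuba recursion\<close>

text \<open>The \<open>k\<close>-th summand, with \<open>A k f\<close> in place of $\bar S_k f$ or
  $S_k \bar f$.\<close>

definition sierpinski_term ::
    "(nat \<Rightarrow> 'a::comm_ring_1 poly \<Rightarrow> 'a poly) \<Rightarrow> nat \<Rightarrow> nat \<Rightarrow> 'a poly \<Rightarrow> 'a poly \<Rightarrow> 'a poly" where
  "sierpinski_term A n k f g = smult (of_int (thue_morse k))
     (S (n-1-k) * ((S (n-1-k) * monom 1 k) \<odot> A k f \<odot> A k g))"

lemma sum_even_odd: "(\<Sum>k<2 * n. t k) = (\<Sum>k<n. t (2 * k) + t (2 * k + 1 :: nat))"
  for t :: "nat \<Rightarrow> 'a::comm_monoid_add"
  by (induction n) (simp_all add: algebra_simps)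

text \<open>Only the odd half matters at odd indices, because the mask deletes the even half there;
  hence \<open>h\<close> is arbitrary.  The factor \<open>c\<close> is 1 for $\bar S_k f$ and
  \<open>- 1\<close> for $S_k \bar f$.\<close>

locale karatsuba_family =
  fixes A :: "nat \<Rightarrow> 'a::comm_ring_1 poly \<Rightarrow> 'a poly" and c :: 'a
  assumes square_1: "c * c = 1"
    and const_poly: "A 0 [:a:] = [:a:]"
    and even_index: "A (2 * k) (interleave p q) = interleave (A k p) (smult c (A k q))"
    and odd_index: "\<exists>h. A (2 * k + 1) (interleave p q) = interleave h (smult c (A k (q - p)))"
begin

lemma termwise_mult_smult: "u \<odot> smult c v \<odot> smult c w = u \<odot> v \<odot> w"
proof (rule poly_eqI)
  fix j
  have "coeff (u \<odot> smult c v \<odot> smult c w) j = c * c * coeff (u \<odot> v \<odot> w) j"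
    by (simp only: coeff_termwise_mult coeff_smult mult_ac)
  then show "coeff (u \<odot> smult c v \<odot> smult c w) j = coeff (u \<odot> v \<odot> w) j"
    by (simp add: square_1)
qed

text \<open>The factor \<open>interleave 1 1\<close> is $1 + x$.  It stems from the outer factor
  $S_{2(n-1-k)+1} = (1+x)\,S_{n-1-k}(x^2)$; in the mask, the same $1 + x$ makes both halves
  survive.\<close>

lemma sierpinski_term_double:
  assumes "k < n"
  shows "sierpinski_term A (2 * n) (2 * k) (interleave p q) (interleave p' q') =
    interleave 1 1 * interleave (sierpinski_term A n k p p') (sierpinski_term A n k q q')"
proof -
  have index: "2 * n - 1 - 2 * k = 2 * (n - 1 - k) + 1" using assms by simp
  show ?thesis
    unfolding sierpinski_term_def index sierpinski_double_plus_1 thue_morse_double monom_double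
      map_poly_of_int_interleave even_index
    by (simp add: interleave_mult interleave_termwise_mult termwise_mult_smult smult_interleave
        algebra_simps smult_add_right)
qed

text \<open>Here the outer factor and the Sierpinski factor of the mask are polynomials in $x^2$, and
  the monomial $x^{2k+1}$ moves the mask to the odd exponents.\<close>

lemma sierpinski_term_double_plus_1:
  assumes "k < n"
  shows "sierpinski_term A (2 * n) (2 * k + 1) (interleave p q) (interleave p' q') =
    interleave 0 (- sierpinski_term A n k (q - p) (q' - p'))"
proof -
  have index: "2 * n - 1 - (2 * k + 1) = 2 * (n - 1 - k)" using assms by simp
  obtain h h' where odd:
    "A (2 * k + 1) (interleave p q) = interleave h (smult c (A k (q - p)))"
    "A (2 * k + 1) (interleave p' q') = interleave h' (smult c (A k (q' - p')))"
    using odd_index by metis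
  have "0 \<odot> u = 0" for u :: "'a poly" by (rule poly_eqI) (simp add: coeff_termwise_mult)
  then show ?thesis
    unfolding sierpinski_term_def index sierpinski_double thue_morse_double_plus_1
      monom_double_plus_1 map_poly_of_int_interleave odd
    by (simp add: interleave_mult interleave_termwise_mult termwise_mult_smult smult_interleave)
qed

lemma sum_sierpinski_term:
  assumes "degree f \<le> 2 ^ r - 1" "degree g \<le> 2 ^ r - 1"
  shows "(\<Sum>k<2 ^ r. sierpinski_term A (2 ^ r) k f g) = f * g"
  using assms
proof (induction r arbitrary: f g)
  case 0
  then obtain a b where "f = [:a:]" "g = [:b:]"
    by (auto elim!: degree_eq_zeroE)
  moreover have "thue_morse 0 = 1" by (simp add: thue_morse_def)
  moreover have "1 \<odot> [:a:] \<odot> [:b:] = [:a * b:]" for a b :: 'a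
    by (rule poly_eqI) (auto simp: coeff_termwise_mult coeff_pCons split: nat.split)
  ultimately show ?case
    by (simp add: sierpinski_term_def sierpinski_0 const_poly monom_0 flip: one_pCons)
next
  case (Suc r)
  define n :: nat where "n = 2 ^ r"
  have n: "2 ^ Suc r = 2 * n" "0 < n" by (simp_all add: n_def)
  obtain p q where f: "f = interleave p q" "degree p \<le> n - 1" "degree q \<le> n - 1"
    using Suc.prems n by (metis ex_interleave)
  obtain p' q' where g: "g = interleave p' q'" "degree p' \<le> n - 1" "degree q' \<le> n - 1"
    using Suc.prems n by (metis ex_interleave)
  let ?t = "sierpinski_term A n"
  have IH: "(\<Sum>k<n. ?t k u v) = u * v" if "degree u \<le> n - 1" "degree v \<le> n - 1" for u v
    using Suc.IH that by (simp add: n_def)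
  have "(\<Sum>k<2 ^ Suc r. sierpinski_term A (2 ^ Suc r) k f g) =
      (\<Sum>k<n. sierpinski_term A (2 * n) (2 * k) f g + sierpinski_term A (2 * n) (2 * k + 1) f g)"
    unfolding n(1) by (rule sum_even_odd)
  also have "\<dots> = (\<Sum>k<n. interleave 1 1 * interleave (?t k p p') (?t k q q')
      + interleave 0 (- ?t k (q - p) (q' - p')))"
    unfolding f(1) g(1)
    by (intro sum.cong refl arg_cong2[where f = "(+)"] sierpinski_term_double
        sierpinski_term_double_plus_1) simp_all
  also have "\<dots> = interleave 1 1 * interleave (p * p') (q * q')
      + interleave 0 (- ((q - p) * (q' - p')))"
    using f g
    by (simp add: sum.distrib interleave_sum sum_negf IH degree_diff_le flip: sum_distrib_left)
  (* Karatsuba's identity. *)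
  also have "\<dots> = f * g"
    unfolding f(1) g(1) by (simp add: interleave_mult interleave_add algebra_simps)
  finally show ?case .
qed

end

text \<open>At odd indices the factor $1 - x$ of $\bar S_{2k+1}$ produces the difference
  \<open>q - p\<close> in the odd half.\<close>

lemma karatsuba_family_signed_sierpinski:
  "karatsuba_family (\<lambda>k f :: 'a::comm_ring_1 poly. S_bar k * f) 1"
proof
  fix k and p q :: "'a poly" and a :: 'a
  have minus: "map_poly of_int (- u) = - (map_poly of_int u :: 'a poly)" for u
    by (rule poly_eqI) (simp add: coeff_map_poly)
  show "S_bar 0 * [:a:] = [:a:]" by (simp add: signed_sierpinski_def)
  show "S_bar (2 * k) * interleave p q = interleave (S_bar k * p) (smult 1 (S_bar k * q))"
    by (simp add: signed_sierpinski_double map_poly_of_int_interleave interleave_mult)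
  show "\<exists>h. S_bar (2 * k + 1) * interleave p q = interleave h (smult 1 (S_bar k * (q - p)))"
    unfolding signed_sierpinski_double_plus_1 map_poly_of_int_interleave minus interleave_mult
    by (auto simp: algebra_simps)
qed simp

text \<open>Here the signs sit in $\bar f$ rather than in the multiplier: $\bar f$ interleaves
  $\bar p$ and $-\bar q$, and the factor $1 + x$ of $S_{2k+1}$ adds them to
  $-(\overline{q - p})$ in the odd half.\<close>

lemma karatsuba_family_sierpinski:
  "karatsuba_family (\<lambda>k f :: 'a::comm_ring_1 poly. S k * signed_poly f) (- 1)"
proof
  fix k and p q :: "'a poly" and a :: 'a
  have "signed_poly [:a:] = [:a:]"
    by (rule poly_eqI) (simp add: coeff_signed_poly coeff_pCons thue_morse_def bot_fun_def split: nat.split)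
  then show "S 0 * signed_poly [:a:] = [:a:]" by (simp add: sierpinski_0)
  show "S (2 * k) * signed_poly (interleave p q) =
      interleave (S k * signed_poly p) (smult (- 1) (S k * signed_poly q))"
    by (simp add: sierpinski_double map_poly_of_int_interleave signed_poly_interleave interleave_mult)
  have diff: "signed_poly (q - p) = signed_poly q - signed_poly p"
    by (rule poly_eqI) (simp add: coeff_signed_poly algebra_simps)
  show "\<exists>h. S (2 * k + 1) * signed_poly (interleave p q) =
      interleave h (smult (- 1) (S k * signed_poly (q - p)))"
    unfolding sierpinski_double_plus_1 map_poly_of_int_interleave signed_poly_interleave
      interleave_mult diff
    by (auto simp: algebra_simps)
qed simp

theorem theorem4p1:
  fixes f g :: "'a::comm_ring_1 poly" and n :: nat
  assumes "\<exists>r. n = 2 ^ r"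
    and "degree f \<le> n - 1" and "degree g \<le> n - 1"
  shows "f * g =
      (\<Sum>k=0..n-1. smult (of_int (thue_morse k))
        (S (n-1-k) * ((S (n-1-k) * monom 1 k) \<odot> (S_bar k * f) \<odot> (S_bar k * g))))
    \<and> (\<Sum>k=0..n-1. smult (of_int (thue_morse k))
        (S (n-1-k) * ((S (n-1-k) * monom 1 k) \<odot> (S_bar k * f) \<odot> (S_bar k * g)))) =
      (\<Sum>k=0..n-1. smult (of_int (thue_morse k))
        (S (n-1-k) * ((S (n-1-k) * monom 1 k) \<odot> (S k * signed_poly f) \<odot> (S k * signed_poly g))))"
proof -
  obtain r where r: "n = 2 ^ r" using assms(1) by blast
  then have range: "{0..n-1} = {..<n}" by (auto simp: Suc_le_eq simp flip: less_Suc_eq_le)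
  show ?thesis
    using karatsuba_family.sum_sierpinski_term[OF karatsuba_family_signed_sierpinski, of f r g]
      karatsuba_family.sum_sierpinski_term[OF karatsuba_family_sierpinski, of f r g] assms(2,3)
    unfolding range by (simp add: sierpinski_term_def flip: r)
qed

end
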